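(* For any $\eta > 0$, there exist $C_1 = C_1(\eta)$, $c_0 = c_0(\eta) > 0$ such that the following holds. Let $0 < p \le 1-\eta$, and let $\epsilon \le c_0/\ln(1/p)$. Let $f : \{0,1\}^n \to \{0,1\}$ be a monotone increasing Boolean function such that $$p\, I^p[f] \le \mu_p(f)\left(\log_p(\mu_p(f)) + \epsilon\right).$$ Then there exists a monotone increasing subcube $S \subset \{0,1\}^n$ such that $$\mu_p(f \Delta 1_S) \le C_1\, \frac{\epsilon \ln(1/p)}{\ln\left(1/(\epsilon \ln(1/p))\right)}\, \mu_p(f).$$
   Context: Here $n$ is a positive integer and $[n]=\{1,\dots,n\}$. For $p \in (0,1)$, $\mu_p$ is the $p$-biased measure on $\{0,1\}^n$: $\mu_p(\{x\}) = p^{\sum_i x_i}(1-p)^{n-\sum_i x_i}$. For a Boolean function $f:\{0,1\}^n\to\{0,1\}$, $\mu_p(f) := \mathbb{E}_{x\sim\mu_p}[f(x)]$. For $i \in [n]$, $I_i^p[f] := \Pr_{x\sim\mu_p}[f(x)\ne f(x\oplus e_i)]$, where $x \oplus e_i$ is $x$ with its $i$th coordinate flipped, and $I^p[f] := \sum_{i=1}^n I_i^p[f]$. $\log_p$ denotes the logarithm to base $p$, with the convention $0\log_p(0)=0$. A function $f:\{0,1\}^n\to\{0,1\}$ is monotone increasing if $f(x)\le f(y)$ whenever $x_i\le y_i$ for all $i\in[n]$; a subset of $\{0,1\}^n$ is monotone increasing if its indicator function is. A subcube of $\{0,1\}^n$ is a set of the form $\{x \in\{0,1\}^n : x_i = a_i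 \ \forall i \in F\}$, where $F \subset [n]$ and $a_i\in\{0,1\}$ for all $i \in F$. $1_S$ is the indicator function of $S$, i.e. the Boolean function equal to $1$ on $S$ and $0$ outside $S$, and $f\Delta 1_S := \{x\in\{0,1\}^n : f(x)\ne 1_S(x)\}$.
   Formalization: The function f is additionally assumed not identically 0; for f = 0 the hypothesis reads 0 ≤ 0, while the conclusion would require a subcube of measure 0, although every subcube is nonempty and has positive measure. *)

theory Defs
  imports Complex_Main "HOL-Library.FuncSet" "HOL-Library.Indicator_Function"
begin

(* The points of {0,1}^n are the extensional functions on {1..n}, so that each point has exactly
   one representative.  The dimension is a term and not a type because the constants of the
   theorem have to be uniform in n. *)
definition cube :: "nat \<Rightarrow> (nat \<Rightarrow> nat) set" where
  "cube n = {1..n} \<rightarrow>\<^sub>E {0, 1}"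

(* On the cube the coordinate sum is at most n, so the subtraction does not truncate. *)
definition biased_weight :: "nat \<Rightarrow> real \<Rightarrow> (nat \<Rightarrow> nat) \<Rightarrow> real" where
  "biased_weight n p x = p ^ (\<Sum>i=1..n. x i) * (1 - p) ^ (n - (\<Sum>i=1..n. x i))"

definition biased_measure :: "nat \<Rightarrow> real \<Rightarrow> (nat \<Rightarrow> nat) set \<Rightarrow> real" where
  "biased_measure n p A = (\<Sum>x\<in>A \<inter> cube n. biased_weight n p x)"

definition biased_expectation :: "nat \<Rightarrow> real \<Rightarrow> ((nat \<Rightarrow> nat) \<Rightarrow> nat) \<Rightarrow> real" where
  "biased_expectation n p f = (\<Sum>x\<in>cube n. biased_weight n p x * real (f x))"

definition flip :: "nat \<Rightarrow> (nat \<Rightarrow> nat) \<Rightarrow> nat \<Rightarrow> nat" where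
  "flip i x = x(i := 1 - x i)"

definition influence :: "nat \<Rightarrow> real \<Rightarrow> nat \<Rightarrow> ((nat \<Rightarrow> nat) \<Rightarrow> nat) \<Rightarrow> real" where
  "influence n p i f = biased_measure n p {x \<in> cube n. f x \<noteq> f (flip i x)}"

definition total_influence :: "nat \<Rightarrow> real \<Rightarrow> ((nat \<Rightarrow> nat) \<Rightarrow> nat) \<Rightarrow> real" where
  "total_influence n p f = (\<Sum>i=1..n. influence n p i f)"

definition boolean_function :: "nat \<Rightarrow> ((nat \<Rightarrow> nat) \<Rightarrow> nat) \<Rightarrow> bool" where
  "boolean_function n f \<longleftrightarrow> f \<in> cube n \<rightarrow> {0, 1}"

definition monotone_increasing :: "nat \<Rightarrow> ((nat \<Rightarrow> nat) \<Rightarrow> nat) \<Rightarrow> bool" where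
  "monotone_increasing n f \<longleftrightarrow>
     (\<forall>x\<in>cube n. \<forall>y\<in>cube n. (\<forall>i\<in>{1..n}. x i \<le> y i) \<longrightarrow> f x \<le> f y)"

definition monotone_increasing_set :: "nat \<Rightarrow> (nat \<Rightarrow> nat) set \<Rightarrow> bool" where
  "monotone_increasing_set n S \<longleftrightarrow> monotone_increasing n (indicator S)"

definition subcube :: "nat \<Rightarrow> (nat \<Rightarrow> nat) set \<Rightarrow> bool" where
  "subcube n S \<longleftrightarrow>
     (\<exists>F a. F \<subseteq> {1..n} \<and> a \<in> F \<rightarrow> {0, 1} \<and> S = {x \<in> cube n. \<forall>i\<in>F. x i = a i})"

definition fun_sym_diff :: "nat \<Rightarrow> ((nat \<Rightarrow> nat) \<Rightarrow> nat) \<Rightarrow> ((nat \<Rightarrow> nat) \<Rightarrow> nat) \<Rightarrow> (nat \<Rightarrow> nat) set" where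
  "fun_sym_diff n f g = {x \<in> cube n. f x \<noteq> g x}"

end

theory Submission
  imports Defs "HOL-Analysis.Convex"
begin

text \<open>Let \<open>X\<close> be a \<open>\<mu>\<^sub>p\<close>-random point conditioned on \<open>f = 1\<close>, and let \<open>q\<^sub>i = P(X\<^sub>i = 1)\<close>. The deficit
  \<open>\<delta>(f) = p ln(1/p) I(f) / \<mu>(f) - ln(1/\<mu>(f))\<close> in the isoperimetric inequality satisfies, by the chain
  rule for relative entropy, the exact recursion
  \<open>\<delta>(f) = h(q\<^sub>i) + q\<^sub>i \<delta>(f\<^sub>i\<^sup>+) + (1 - q\<^sub>i) \<delta>(f\<^sub>i\<^sup>-)\<close>, where \<open>f\<^sub>i\<^sup>+\<close> and \<open>f\<^sub>i\<^sup>-\<close> are the restrictions of \<open>f\<close> to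
  \<open>x\<^sub>i = 1\<close> and \<open>x\<^sub>i = 0\<close>, and \<open>h = gap p\<close> is concave and vanishes at \<open>p\<close> and \<open>1\<close>. Hence a small deficit forces
  every \<open>q\<^sub>i\<close> to be close to \<open>p\<close> or to \<open>1\<close>. If some \<open>q\<^sub>i = 1 - t\<close> is close to \<open>1\<close>, pass to \<open>f\<^sub>i\<^sup>+\<close>: this adds \<open>t\<close>
  to the relative distance from a subcube, and the deficit drops by \<open>h(q\<^sub>i) \<ge> (t/2) ln(1/t)\<close>, which pays
  for it. If no \<open>q\<^sub>i\<close> is close to \<open>1\<close>, induction on the dimension shows that \<open>\<mu>(f)\<close> is close to \<open>1\<close>; then
  the isoperimetric inequality for the complement bounds \<open>1 - \<mu>(f)\<close>.\<close>

section \<open>The entropy gap of one coordinate\<close>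

definition bin_entropy :: "real \<Rightarrow> real" where
  "bin_entropy q = - q * ln q - (1 - q) * ln (1 - q)"

text \<open>The subtracted term is affine in q, agrees with the entropy at p and vanishes at 1, so
  this is the entropy minus its chord over [p, 1].\<close>

definition gap :: "real \<Rightarrow> real \<Rightarrow> real" where
  "gap p q = bin_entropy q - (1 - q) / (1 - p) * bin_entropy p"

lemma concave_on_bin_entropy: "concave_on {0<..<1} bin_entropy"
proof (rule f''_le0_imp_concave)
  fix x :: real assume x: "x \<in> {0<..<1}"
  show "(bin_entropy has_real_derivative ln (1 - x) - ln x) (at x)"
    unfolding bin_entropy_def using x
    by (auto intro!: derivative_eq_intros simp: divide_simps)
  show "((\<lambda>x. ln (1 - x) - ln x) has_real_derivative - 1 / (1 - x) - 1 / x) (at x)"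
    using x by (auto intro!: derivative_eq_intros simp: field_simps)
  show "- 1 / (1 - x) - 1 / x \<le> 0"
    using x by (simp add: field_simps)
qed simp

lemma concave_on_gap:
  assumes "0 < p" "p < 1"
  shows "concave_on {0<..<1} (gap p)"
proof -
  define c where "c = bin_entropy p / (1 - p)"
  have "convex_on {0<..<1::real} (\<lambda>q. c - c * q)"
    by (rule f''_ge0_imp_convex[where f' = "\<lambda>_. - c" and f'' = "\<lambda>_. 0"])
      (auto intro!: derivative_eq_intros)
  also have "(\<lambda>q. c - c * q) = (\<lambda>q. (1 - q) / (1 - p) * bin_entropy p)"
    by (simp add: c_def fun_eq_iff diff_divide_distrib algebra_simps)
  finally have "convex_on {0<..<1::real} (\<lambda>q. (1 - q) / (1 - p) * bin_entropy p)" .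
  from concave_on_diff[OF concave_on_bin_entropy this] show ?thesis
    by (simp add: gap_def[abs_def])
qed

lemma gap_near_1:
  assumes "0 < p" "p < 1" "bin_entropy p / (1 - p) \<le> K" "0 \<le> t" "t \<le> exp (- 2 * K)" "t < 1"
  shows "t / 2 * ln (1 / t) \<le> gap p (1 - t)"
proof (cases "t = 0")
  case True
  then show ?thesis by (simp add: gap_def bin_entropy_def)
next
  case False
  with assms have t: "0 < t" by simp
  have "ln t \<le> - 2 * K"
    using assms(5) t by (metis ln_exp ln_le_cancel_iff exp_gt_zero)
  then have "bin_entropy p / (1 - p) \<le> - ln t / 2" using assms(3) by linarith
  then have "t * (bin_entropy p / (1 - p)) \<le> t * (- ln t / 2)"
    using t by (intro mult_left_mono) auto
  moreover have "(1 - t) * ln (1 - t) \<le> 0"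
    using t assms by (intro mult_nonneg_nonpos) auto
  ultimately show ?thesis
    using t unfolding gap_def bin_entropy_def[of "1 - t"] by (simp add: ln_div algebra_simps)
qed

text \<open>By concavity \<open>gap p\<close> lies above its chord from p, where it is 0, to 1 - s,
  where \<open>gap_near_1\<close> applies.\<close>

lemma gap_lower_bound:
  assumes "0 < p" "p < 1" "bin_entropy p / (1 - p) \<le> K" "0 < s" "s \<le> exp (- 2 * K)" "s < 1"
    and "p \<le> q" "q \<le> 1 - s"
  shows "s / 2 * ln (1 / s) * (q - p) \<le> gap p q"
proof (cases "q = p")
  case True
  then show ?thesis using assms by (simp add: gap_def)
next
  case False
  \<comment> \<open>The weight of 1 - s when q is written as a convex combination of p and 1 - s.
    The interval has length at most 1, so u >= q - p.\<close>
  define u where "u = (q - p) / (1 - s - p)"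
  have d: "0 < 1 - s - p" "1 - s - p \<le> 1" using False assms by auto
  have u: "0 \<le> u" "u \<le> 1" "q - p \<le> u" "q = (1 - u) * p + u * (1 - s)"
  proof -
    show "0 \<le> u" "u \<le> 1" using assms d by (auto simp: u_def field_simps)
    have "(q - p) * (1 - s - p) \<le> (q - p) * 1" using d assms by (intro mult_left_mono) auto
    then show "q - p \<le> u" using d by (simp add: u_def field_simps)
    have "u * (1 - s - p) = q - p" using d by (simp add: u_def)
    then show "q = (1 - u) * p + u * (1 - s)" by (simp add: algebra_simps)
  qed
  have pos: "0 \<le> s / 2 * ln (1 / s)" using assms by simp
  have "s / 2 * ln (1 / s) * (q - p) \<le> s / 2 * ln (1 / s) * u"
    using u(3) pos by (rule mult_left_mono)
  also have "\<dots> \<le> u * gap p (1 - s)"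
    using gap_near_1[of p K s] assms u(1) by (subst mult.commute) (intro mult_left_mono, auto)
  also have "\<dots> = (1 - u) * gap p p + u * gap p (1 - s)"
    using assms by (simp add: gap_def)
  also have "\<dots> \<le> gap p q"
    using concave_onD[OF concave_on_gap[OF assms(1,2)] u(1,2), of p "1 - s"] assms d
    by (simp add: u(4)[symmetric])
  finally show ?thesis .
qed

text \<open>Concavity is available on the open interval only, so the end q = 1 is reached by
  \<open>gap_near_1\<close>. The split point s may depend on p here.\<close>

lemma gap_nonneg:
  assumes "0 < p" "p < 1" "p \<le> q" "q \<le> 1"
  shows "0 \<le> gap p q"
proof -
  define K where "K = bin_entropy p / (1 - p)"
  define s where "s = min (exp (- 2 * K)) (1 / 2)"
  have s: "0 < s" "s < 1" "s \<le> exp (- 2 * K)" by (auto simp: s_def)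
  show ?thesis
  proof (cases "q \<le> 1 - s")
    case True
    have "0 \<le> s / 2 * ln (1 / s) * (q - p)" using s assms by simp
    also have "\<dots> \<le> gap p q"
      using True s assms by (intro gap_lower_bound[of p K]) (auto simp: K_def)
    finally show ?thesis .
  next
    case False
    have "0 \<le> (1 - q) / 2 * ln (1 / (1 - q))"
      using assms by (cases "q = 1") auto
    also have "\<dots> \<le> gap p (1 - (1 - q))"
      using False s assms by (intro gap_near_1[of p K]) (auto simp: K_def)
    finally show ?thesis by simp
  qed
qed

text \<open>From ln (1/p) <= 1/p - 1. This bound is uniform in p and lets all later constants depend
  on \<eta> alone.\<close>

lemma bin_entropy_ratio_le:
  assumes "0 < \<eta>" "0 < p" "p \<le> 1 - \<eta>"
  shows "bin_entropy p / (1 - p) \<le> 1 + ln (1 / \<eta>)"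
proof -
  have "ln \<eta> \<le> ln (1 - p)" "ln (1 / \<eta>) = - ln \<eta>" using assms by (simp_all add: ln_div)
  moreover have "- p * ln p \<le> 1 - p"
    using assms ln_le_minus_one[of "1 / p"] by (simp add: ln_div field_simps)
  then have "- p * ln p / (1 - p) \<le> 1" using assms by (subst pos_divide_le_eq) auto
  moreover have "bin_entropy p / (1 - p) = - p * ln p / (1 - p) - ln (1 - p)"
    using assms by (simp add: bin_entropy_def diff_divide_distrib)
  ultimately show ?thesis by linarith
qed

text \<open>The chain rule for relative entropy over one coordinate, in unnormalised form.\<close>
lemma two_point_entropy:
  fixes a b p :: real
  assumes "0 < p" "p < 1" "0 \<le> a" "0 \<le> b" and m: "m = p * a + (1 - p) * b" "0 < m"
  shows "p * ln (1 / p) * (a - b) - p * a * ln a - (1 - p) * b * ln b + m * ln m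
       = m * gap p (p * a / m)"
proof -
  have q: "1 - p * a / m = (1 - p) * b / m" using m by (simp add: field_simps)
  have A: "p * a * ln (p * a / m) = p * a * (ln p + ln a - ln m)"
    using assms by (cases "a = 0") (auto simp: ln_mult ln_div)
  have B: "(1 - p) * b * ln ((1 - p) * b / m) = (1 - p) * b * (ln (1 - p) + ln b - ln m)"
    using assms by (cases "b = 0") (auto simp: ln_mult ln_div)
  have C: "m * ((1 - p) * b / m / (1 - p) * bin_entropy p) = b * bin_entropy p"
    using assms(1,2) m(2) by simp
  have D: "m * (p * a / m * x) = p * a * x" "m * ((1 - p) * b / m * x) = (1 - p) * b * x" for x
    using m(2) by auto
  have "m * gap p (p * a / m) = - (p * a * ln (p * a / m)) - (1 - p) * b * ln ((1 - p) * b / m)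
      - b * bin_entropy p"
    unfolding gap_def bin_entropy_def[of "p * a / m"] q right_diff_distrib C
      minus_mult_left[symmetric] mult_minus_right D by (rule refl)
  also have "\<dots> = p * ln (1 / p) * (a - b) - p * a * ln a - (1 - p) * b * ln b + m * ln m"
    unfolding A B bin_entropy_def using assms(1) by (simp add: m(1) ln_div algebra_simps)
  finally show ?thesis by simp
qed

section \<open>Monotone families under the biased measure\<close>

text \<open>A point of the cube is identified with the set of its coordinates equal to \<open>1\<close>, so that restricting
  coordinate \<open>i\<close> to \<open>0\<close> or \<open>1\<close> turns \<open>P\<close> on \<open>V\<close> into \<open>P\<close> or \<open>\<lambda>X. P (insert i X)\<close> on \<open>V - {i}\<close>.\<close>
definition measure_pred :: "real \<Rightarrow> 'a set \<Rightarrow> ('a set \<Rightarrow> bool) \<Rightarrow> real" where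
  "measure_pred p V P = (\<Sum>X\<in>Pow V. p ^ card X * (1 - p) ^ card (V - X) * of_bool (P X))"

text \<open>Agrees with the total influence only for monotone \<open>P\<close>.\<close>
definition influence_pred :: "real \<Rightarrow> 'a set \<Rightarrow> ('a set \<Rightarrow> bool) \<Rightarrow> real" where
  "influence_pred p V P =
     (\<Sum>i\<in>V. measure_pred p (V - {i}) (\<lambda>X. P (insert i X)) - measure_pred p (V - {i}) P)"

text \<open>The factor ln (1/p) turns log_p into -ln. At measure 0 the value is meaningless, and
  \<open>deficit_split\<close> multiplies it by the weight 0.\<close>

definition deficit :: "real \<Rightarrow> 'a set \<Rightarrow> ('a set \<Rightarrow> bool) \<Rightarrow> real" where
  "deficit p V P =
     p * ln (1 / p) * influence_pred p V P / measure_pred p V P + ln (measure_pred p V P)"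

text \<open>Bayes' rule for the probability that coordinate i is 1, given P.\<close>

definition cond_prob :: "real \<Rightarrow> 'a set \<Rightarrow> ('a set \<Rightarrow> bool) \<Rightarrow> 'a \<Rightarrow> real" where
  "cond_prob p V P i =
     p * measure_pred p (V - {i}) (\<lambda>X. P (insert i X)) / measure_pred p V P"

lemma measure_pred_cong:
  "(\<And>X. X \<subseteq> V \<Longrightarrow> P X = Q X) \<Longrightarrow> measure_pred p V P = measure_pred p V Q"
  unfolding measure_pred_def by (rule sum.cong) auto

lemma measure_pred_nonneg:
  assumes "0 < p" "p < 1"
  shows "0 \<le> measure_pred p V P"
  using assms by (simp add: measure_pred_def sum_nonneg)

lemma measure_pred_mono:
  assumes "0 < p" "p < 1" "\<And>X. X \<subseteq> V \<Longrightarrow> P X \<Longrightarrow> Q X"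
  shows "measure_pred p V P \<le> measure_pred p V Q"
  unfolding measure_pred_def using assms by (intro sum_mono mult_left_mono) auto

lemma measure_pred_eq_0_iff:
  assumes "finite V" "0 < p" "p < 1"
  shows "measure_pred p V P = 0 \<longleftrightarrow> (\<forall>X\<subseteq>V. \<not> P X)"
  unfolding measure_pred_def using assms by (subst sum_nonneg_eq_0_iff) auto

lemma measure_pred_split:
  assumes "finite V" "i \<in> V"
  shows "measure_pred p V P = p * measure_pred p (V - {i}) (\<lambda>X. P (insert i X))
           + (1 - p) * measure_pred p (V - {i}) P"
proof -
  define W where "W = V - {i}"
  have W: "V = insert i W" "i \<notin> W" "finite W" using assms by (auto simp: W_def)
  have inj: "inj_on (insert i) (Pow W)" using W(2) by (auto simp: inj_on_def)
  have disj: "Pow W \<inter> insert i ` Pow W = {}" using W(2) by auto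
  have c1: "card (insert i X) = Suc (card X)" "card (insert i W - X) = Suc (card (W - X))"
      "insert i W - insert i X = W - X" if "X \<subseteq> W" for X
  proof -
    have fin: "finite X" "i \<notin> X" using that W finite_subset by auto
    show "card (insert i X) = Suc (card X)" using fin by simp
    have "insert i W - X = insert i (W - X)" using fin by auto
    then show "card (insert i W - X) = Suc (card (W - X))" using W by simp
    show "insert i W - insert i X = W - X" using W(2) by auto
  qed
  define g where "g X = p ^ card X * (1 - p) ^ card (V - X) * of_bool (P X)" for X
  have "measure_pred p V P = sum g (Pow W) + sum g (insert i ` Pow W)"
    unfolding measure_pred_def g_def[symmetric] unfolding W(1) Pow_insert
    using W(3) disj by (intro sum.union_disjoint) auto
  also have "sum g (insert i ` Pow W) = (\<Sum>X\<in>Pow W. g (insert i X))"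
    using sum.reindex[OF inj, of g] by (simp add: o_def)
  also have "\<dots> = p * measure_pred p W (\<lambda>X. P (insert i X))"
    unfolding measure_pred_def sum_distrib_left
  proof (rule sum.cong[OF refl])
    fix X assume "X \<in> Pow W"
    then have X: "X \<subseteq> W" by simp
    show "g (insert i X) = p * (p ^ card X * (1 - p) ^ card (W - X) * of_bool (P (insert i X)))"
      unfolding g_def W(1) c1(1)[OF X] c1(3)[OF X] by simp
  qed
  also have "sum g (Pow W) = (1 - p) * measure_pred p W P"
    unfolding measure_pred_def sum_distrib_left
    by (rule sum.cong) (auto simp: g_def W(1) c1)
  finally show ?thesis by (simp add: W_def)
qed

lemma measure_pred_True:
  assumes "finite V"
  shows "measure_pred p V (\<lambda>_. True) = 1"
  using assms
proof (induction rule: finite_induct)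
  case empty
  show ?case by (simp add: measure_pred_def)
next
  case (insert i V)
  then show ?case using measure_pred_split[of "insert i V" i p "\<lambda>_. True"] by simp
qed

lemma measure_pred_not:
  assumes "finite V"
  shows "measure_pred p V (\<lambda>X. \<not> P X) = 1 - measure_pred p V P"
proof -
  have "measure_pred p V P + measure_pred p V (\<lambda>X. \<not> P X) = measure_pred p V (\<lambda>_. True)"
    unfolding measure_pred_def sum.distrib[symmetric] by (intro sum.cong) (auto simp: of_bool_def)
  then show ?thesis using measure_pred_True[OF assms, of p] by simp
qed

text \<open>Complementation exchanges the zeros and ones of a point, hence p and 1 - p.\<close>

lemma measure_pred_complement:
  assumes "finite V"
  shows "measure_pred (1 - p) V (\<lambda>X. P (V - X)) = measure_pred p V P"
  unfolding measure_pred_def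
  by (rule sum.reindex_bij_witness[of _ "\<lambda>X. V - X" "\<lambda>X. V - X"])
    (auto simp: double_diff mult_ac)

lemma measure_pred_le_1:
  assumes "finite V" "0 < p" "p < 1"
  shows "measure_pred p V P \<le> 1"
  using measure_pred_mono[of p V P "\<lambda>_. True"] measure_pred_True[of V p] assms by simp

lemma mono_insert: "mono P \<Longrightarrow> mono (\<lambda>X. P (insert i X))"
  for P :: "'a set \<Rightarrow> bool"
  by (auto simp: mono_def) (meson insert_mono)

lemma measure_pred_insert_ge:
  assumes "0 < p" "p < 1" "mono P"
  shows "measure_pred p V P \<le> measure_pred p V (\<lambda>X. P (insert i X))"
  using assms(1,2) by (rule measure_pred_mono) (use monoD[OF assms(3), OF subset_insertI] in auto)

text \<open>The term of i is kept; every other term is a difference of two measures, and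
  \<open>measure_pred_split\<close> at i applies to both.\<close>

lemma influence_pred_split:
  assumes "finite V" "i \<in> V"
  shows "influence_pred p V P =
    measure_pred p (V - {i}) (\<lambda>X. P (insert i X)) - measure_pred p (V - {i}) P
    + p * influence_pred p (V - {i}) (\<lambda>X. P (insert i X))
    + (1 - p) * influence_pred p (V - {i}) P"
proof -
  have "measure_pred p (V - {j}) (\<lambda>X. P (insert j X)) - measure_pred p (V - {j}) P
    = p * (measure_pred p (V - {i} - {j}) (\<lambda>X. P (insert i (insert j X)))
          - measure_pred p (V - {i} - {j}) (\<lambda>X. P (insert i X)))
    + (1 - p) * (measure_pred p (V - {i} - {j}) (\<lambda>X. P (insert j X))
          - measure_pred p (V - {i} - {j}) P)" if "j \<in> V - {i}" for j
  proof -
    have "i \<in> V - {j}" "finite (V - {j})" and eq: "V - {j} - {i} = V - {i} - {j}"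
      using that assms by auto
    then show ?thesis
      using measure_pred_split[of "V - {j}" i p P]
        measure_pred_split[of "V - {j}" i p "\<lambda>X. P (insert j X)"]
      by (simp add: eq insert_commute algebra_simps)
  qed
  then have "(\<Sum>j\<in>V - {i}. measure_pred p (V - {j}) (\<lambda>X. P (insert j X)) - measure_pred p (V - {j}) P)
    = p * influence_pred p (V - {i}) (\<lambda>X. P (insert i X))
      + (1 - p) * influence_pred p (V - {i}) P"
    unfolding influence_pred_def sum_distrib_left sum.distrib[symmetric] by (rule sum.cong[OF refl])
  then show ?thesis
    using sum.remove[OF assms, of
        "\<lambda>j. measure_pred p (V - {j}) (\<lambda>X. P (insert j X)) - measure_pred p (V - {j}) P"]
    unfolding influence_pred_def[of p V P] by simp
qed

text \<open>Complementation exchanges the two restrictions at i and negation reverses the sign of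
  their difference; the two effects cancel.\<close>

lemma influence_pred_complement:
  assumes "finite V"
  shows "influence_pred (1 - p) V (\<lambda>X. \<not> P (V - X)) = influence_pred p V P"
  unfolding influence_pred_def
proof (rule sum.cong[OF refl])
  fix i assume i: "i \<in> V"
  let ?W = "V - {i}"
  have fin: "finite ?W" using assms by simp
  have eq: "P (V - insert i X) = P (?W - X)" for X by (rule arg_cong[where f = P]) auto
  have "measure_pred (1 - p) ?W (\<lambda>X. \<not> P (V - insert i X)) = measure_pred p ?W (\<lambda>X. \<not> P X)"
    unfolding eq by (rule measure_pred_complement[OF fin])
  moreover have "P (V - X) = P (insert i (?W - X))" if "X \<subseteq> ?W" for X
    using i that by (intro arg_cong[where f = P]) auto
  then have "measure_pred (1 - p) ?W (\<lambda>X. \<not> P (V - X))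
      = measure_pred (1 - p) ?W (\<lambda>X. \<not> P (insert i (?W - X)))"
    by (intro measure_pred_cong) simp
  then have "measure_pred (1 - p) ?W (\<lambda>X. \<not> P (V - X))
      = measure_pred p ?W (\<lambda>X. \<not> P (insert i X))"
    by (simp only: measure_pred_complement[OF fin, of p "\<lambda>X. \<not> P (insert i X)"])
  ultimately show "measure_pred (1 - p) ?W (\<lambda>X. \<not> P (V - insert i X))
      - measure_pred (1 - p) ?W (\<lambda>X. \<not> P (V - X))
    = measure_pred p ?W (\<lambda>X. P (insert i X)) - measure_pred p ?W P"
    using assms by (simp add: measure_pred_not)
qed

text \<open>A family of measure 0 has no members. Thus the deficit can be multiplied by the measure
  in \<open>deficit_split\<close> even when the measure is 0.\<close>

lemma influence_pred_eq_0:
  assumes "finite V" "0 < p" "p < 1" "mono P" "measure_pred p V P = 0"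
  shows "influence_pred p V P = 0"
proof -
  have "measure_pred p (V - {i}) (\<lambda>X. P (insert i X)) = 0" "measure_pred p (V - {i}) P = 0"
    if "i \<in> V" for i
  proof -
    have "\<not> P X" if "X \<subseteq> V" for X using assms that by (simp add: measure_pred_eq_0_iff)
    then have "\<not> P (insert i X)" "\<not> P X" if "X \<subseteq> V - {i}" for X
      using that \<open>i \<in> V\<close> by (auto simp: subset_Diff_insert)
    then show "measure_pred p (V - {i}) (\<lambda>X. P (insert i X)) = 0" "measure_pred p (V - {i}) P = 0"
      using assms by (simp_all add: measure_pred_eq_0_iff)
  qed
  then show ?thesis by (simp add: influence_pred_def)
qed

section \<open>Conditional coordinate probabilities and the recursion for the deficit\<close>

text \<open>Monotonicity makes the restriction to 1 at least as large as the restriction to 0, hence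
  at least as large as their average; this is p <= q. The last two facts convert the weights p and 1
  - p of the restrictions into q and 1 - q.\<close>

lemma cond_prob_bounds:
  assumes "finite V" "0 < p" "p < 1" "mono P" "0 < measure_pred p V P" "i \<in> V"
  shows "p \<le> cond_prob p V P i" "cond_prob p V P i \<le> 1"
    and "cond_prob p V P i * measure_pred p V P
           = p * measure_pred p (V - {i}) (\<lambda>X. P (insert i X))"
    and "(1 - cond_prob p V P i) * measure_pred p V P = (1 - p) * measure_pred p (V - {i}) P"
proof -
  let ?a = "measure_pred p (V - {i}) (\<lambda>X. P (insert i X))" and ?b = "measure_pred p (V - {i}) P"
  let ?m = "measure_pred p V P"
  have m: "?m = p * ?a + (1 - p) * ?b" using assms by (intro measure_pred_split)
  have ab: "0 \<le> ?b" "?b \<le> ?a"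
    using assms by (auto intro: measure_pred_nonneg measure_pred_insert_ge)
  have "(1 - p) * ?b \<le> (1 - p) * ?a" using ab assms by (intro mult_left_mono) auto
  then have "?m \<le> ?a" unfolding m by (simp add: algebra_simps)
  then show "p \<le> cond_prob p V P i" using assms by (simp add: cond_prob_def pos_le_divide_eq)
  show "cond_prob p V P i \<le> 1"
    using assms ab by (simp add: cond_prob_def pos_divide_le_eq m)
  show q: "cond_prob p V P i * ?m = p * ?a" using assms by (simp add: cond_prob_def)
  show "(1 - cond_prob p V P i) * ?m = (1 - p) * ?b" using q m by (simp only: left_diff_distrib mult_1_left)
qed

text \<open>After multiplication by the measure, \<open>influence_pred_split\<close> separates the
  influences of the restrictions, and \<open>two_point_entropy\<close> collects what remains into
  the gap.\<close>

lemma deficit_split: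
  assumes "finite V" "0 < p" "p < 1" "mono P" "0 < measure_pred p V P" "i \<in> V"
  defines "q \<equiv> cond_prob p V P i"
  shows "deficit p V P = gap p q + q * deficit p (V - {i}) (\<lambda>X. P (insert i X))
           + (1 - q) * deficit p (V - {i}) P"
proof -
  let ?a = "measure_pred p (V - {i}) (\<lambda>X. P (insert i X))" and ?b = "measure_pred p (V - {i}) P"
  let ?m = "measure_pred p V P" and ?l = "p * ln (1 / p)"
  have nn: "0 \<le> ?a" "0 \<le> ?b" using assms by (auto intro: measure_pred_nonneg)
  \<comment> \<open>This form also holds at measure 0, where both sides are 0.\<close>
  have unnorm: "measure_pred p W Q * deficit p W Q
      = ?l * influence_pred p W Q + measure_pred p W Q * ln (measure_pred p W Q)"
    if "finite W" "mono Q" for W :: "'a set" and Q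
    using influence_pred_eq_0[of W p Q] that assms(2,3)
    by (cases "measure_pred p W Q = 0") (auto simp: deficit_def field_simps)
  note u = unnorm[OF assms(1,4)] unnorm[of "V - {i}" P]
    unnorm[of "V - {i}" "\<lambda>X. P (insert i X)"]
  have "?m * deficit p V P = ?l * influence_pred p V P + ?m * ln ?m" by (rule u)
  also have "\<dots> = (?l * (?a - ?b) - p * ?a * ln ?a - (1 - p) * ?b * ln ?b + ?m * ln ?m)
      + p * (?l * influence_pred p (V - {i}) (\<lambda>X. P (insert i X)) + ?a * ln ?a)
      + (1 - p) * (?l * influence_pred p (V - {i}) P + ?b * ln ?b)"
    unfolding influence_pred_split[OF assms(1,6)] by (simp add: algebra_simps)
  also have "\<dots> = ?m * gap p (p * ?a / ?m)
      + p * (?a * deficit p (V - {i}) (\<lambda>X. P (insert i X)))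
      + (1 - p) * (?b * deficit p (V - {i}) P)"
    using u(2,3) assms nn mono_insert[OF assms(4)] measure_pred_split[OF assms(1,6), of p P]
    by (subst two_point_entropy) auto
  also have "\<dots> = ?m * (gap p q + q * deficit p (V - {i}) (\<lambda>X. P (insert i X))
           + (1 - q) * deficit p (V - {i}) P)"
  proof -
    have "p * (?a * x) = ?m * (q * x)" "(1 - p) * (?b * x) = ?m * ((1 - q) * x)" for x
      using cond_prob_bounds(3,4)[OF assms(1-6)] unfolding q_def
      by (metis mult.assoc mult.commute)+
    then show ?thesis by (simp add: q_def cond_prob_def distrib_left)
  qed
  finally show ?thesis using assms(5) by simp
qed

text \<open>The biased edge-isoperimetric inequality p I >= \<mu> log_p \<mu>: all terms of
  \<open>deficit_split\<close> are nonnegative, by \<open>gap_nonneg\<close> and induction.\<close>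

lemma deficit_nonneg:
  assumes "finite V" "0 < p" "p < 1" "mono P" "0 < measure_pred p V P"
  shows "0 \<le> deficit p V P"
  using assms
proof (induction V arbitrary: P rule: finite_induct)
  case empty
  have "measure_pred p {} P = 1"
    using empty.prems(4) by (auto simp: measure_pred_def of_bool_def split: if_splits)
  then show ?case by (simp add: deficit_def influence_pred_def)
next
  case (insert i V)
  let ?V = "insert i V" and ?q = "cond_prob p (insert i V) P i"
  have fin: "finite ?V" "i \<in> ?V" and V: "?V - {i} = V" using insert by auto
  note c = cond_prob_bounds[OF fin(1) insert.prems fin(2), unfolded V]
  have pos: "0 < measure_pred p V (\<lambda>X. P (insert i X))"
    using c(1,3) insert.prems by (smt (verit) mult_pos_pos zero_less_mult_pos)
  have "0 \<le> ?q * deficit p V (\<lambda>X. P (insert i X))"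
    using insert.IH[OF insert.prems(1,2) mono_insert[OF insert.prems(3)] pos] c(1) insert.prems
    by simp
  moreover have "0 \<le> (1 - ?q) * deficit p V P"
  proof (cases "measure_pred p V P = 0")
    \<comment> \<open>The induction hypothesis needs positive measure; here the weight 1 - q is 0
      instead.\<close>
    case True
    then show ?thesis using c(4) insert.prems by simp
  next
    case False
    then have "0 < measure_pred p V P"
      using measure_pred_nonneg[OF insert.prems(1,2), of V P] by simp
    then show ?thesis using insert.IH[OF insert.prems(1-3)] c(2) by simp
  qed
  moreover have "0 \<le> gap p ?q" using c insert.prems by (intro gap_nonneg)
  ultimately show ?case
    using deficit_split[OF fin(1) insert.prems fin(2)] unfolding V by simp
qed

lemma measure_pred_empty:
  assumes "0 < measure_pred p {} P"
  shows "measure_pred p {} P = 1"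
  using assms by (auto simp: measure_pred_def of_bool_def split: if_splits)

section \<open>The dual inequality and families of measure close to 1\<close>

lemma influence_pred_nonneg:
  assumes "0 < p" "p < 1" "mono P"
  shows "0 \<le> influence_pred p V P"
  unfolding influence_pred_def using measure_pred_insert_ge[OF assms] by (simp add: sum_nonneg)

text \<open>This is \<open>deficit_nonneg\<close> for the dual
  function \<open>X \<mapsto> \<not> P (V - X)\<close> under the bias \<open>1 - p\<close>.\<close>
lemma dual_isoperimetric:
  assumes "finite V" "0 < p" "p < 1" "mono P"
  defines "\<nu> \<equiv> 1 - measure_pred p V P"
  shows "\<nu> * ln (1 / \<nu>) \<le> (1 - p) * ln (1 / (1 - p)) * influence_pred p V P"
proof (cases "\<nu> = 0")
  case True
  have "0 \<le> (1 - p) * ln (1 / (1 - p)) * influence_pred p V P"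
    using assms influence_pred_nonneg by (intro mult_nonneg_nonneg) auto
  then show ?thesis using True by simp
next
  case False
  then have pos: "0 < \<nu>" using measure_pred_le_1[OF assms(1-3), of P] by (simp add: \<nu>_def)
  have m: "measure_pred (1 - p) V (\<lambda>X. \<not> P (V - X)) = \<nu>"
    using measure_pred_complement[OF assms(1), of p "\<lambda>X. \<not> P X"] assms(1)
    by (simp add: \<nu>_def measure_pred_not)
  have "mono (\<lambda>X. \<not> P (V - X))"
  proof (rule monoI)
    fix X Y :: "'a set" assume "X \<le> Y"
    then have "P (V - Y) \<le> P (V - X)" by (intro monoD[OF assms(4)]) auto
    then show "(\<not> P (V - X)) \<le> (\<not> P (V - Y))" by auto
  qed
  from deficit_nonneg[OF assms(1) _ _ this, of "1 - p"] assms pos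
  have "0 \<le> (1 - p) * ln (1 / (1 - p)) * influence_pred p V P / \<nu> + ln \<nu>"
    by (simp add: m deficit_def influence_pred_complement)
  then have "0 \<le> \<nu> * ((1 - p) * ln (1 / (1 - p)) * influence_pred p V P / \<nu> + ln \<nu>)"
    using pos by (intro mult_nonneg_nonneg) auto
  then show ?thesis using pos by (simp add: distrib_left ln_div)
qed

text \<open>The influence term is at least \<eta> \<nu> ln (1/\<nu>) by duality, and the logarithmic
  term is at least -\<nu>. The threshold exp (-2/\<eta>) is chosen so that \<nu> is at most half of
  the former.\<close>

lemma deficit_ge_complement:
  assumes "finite V" "0 < \<eta>" "0 < p" "p \<le> 1 - \<eta>" "mono P" "0 < measure_pred p V P"
  defines "\<nu> \<equiv> 1 - measure_pred p V P"
  assumes \<nu>: "\<nu> \<le> exp (- 2 / \<eta>)"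
  shows "\<eta> / 2 * (\<nu> * ln (1 / \<nu>)) \<le> measure_pred p V P * deficit p V P"
proof -
  let ?m = "measure_pred p V P" and ?I = "influence_pred p V P"
  have p: "p < 1" using assms by simp
  have I: "0 \<le> ?I" using assms p by (intro influence_pred_nonneg)
  have \<nu>0: "0 \<le> \<nu>" using measure_pred_le_1[OF assms(1,3) p, of P] by (simp add: \<nu>_def)
  have "- \<nu> \<le> ?m * ln ?m"
  proof -
    have "?m * (- ln ?m) \<le> ?m * (1 / ?m - 1)"
      using ln_le_minus_one[of "1 / ?m"] assms(6) by (intro mult_left_mono) (auto simp: ln_div)
    then show ?thesis using assms(6) by (simp add: \<nu>_def algebra_simps)
  qed
  \<comment> \<open>The dual constant is compared with p ln (1/p) through (1 - p) ln (1/(1 - p)) <=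
    p and 1 - p <= ln (1/p). This uses up one factor 1 - p, which is at least \<eta>.\<close>
  moreover have "\<eta> * (\<nu> * ln (1 / \<nu>)) \<le> p * ln (1 / p) * ?I"
  proof -
    have "0 \<le> \<nu> * ln (1 / \<nu>)"
    proof (cases "\<nu> = 0")
      case False
      then show ?thesis using \<nu>0 assms(6) by (intro mult_nonneg_nonneg) (auto simp: \<nu>_def)
    qed simp
    then have "\<eta> * (\<nu> * ln (1 / \<nu>)) \<le> (1 - p) * (\<nu> * ln (1 / \<nu>))"
      using assms(4) by (intro mult_right_mono) auto
    also have "\<dots> \<le> (1 - p) * ((1 - p) * ln (1 / (1 - p)) * ?I)"
      using dual_isoperimetric[OF assms(1,3) p assms(5)] p unfolding \<nu>_def
      by (intro mult_left_mono) auto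
    also have "\<dots> \<le> (1 - p) * (p * ?I)"
    proof -
      have "ln (1 / (1 - p)) \<le> 1 / (1 - p) - 1" using p by (intro ln_le_minus_one) simp
      then have "(1 - p) * ln (1 / (1 - p)) \<le> (1 - p) * (1 / (1 - p) - 1)"
        using p by (intro mult_left_mono) auto
      also have "\<dots> = p" using p by (simp add: algebra_simps)
      finally show ?thesis using I p by (intro mult_left_mono mult_right_mono) auto
    qed
    also have "\<dots> = p * (1 - p) * ?I" by simp
    also have "\<dots> \<le> p * ln (1 / p) * ?I"
      using ln_le_minus_one[OF assms(3)] assms(3) I
      by (intro mult_right_mono mult_left_mono) (auto simp: ln_div)
    finally show ?thesis .
  qed
  moreover have "\<nu> \<le> \<eta> / 2 * (\<nu> * ln (1 / \<nu>))"
  proof (cases "\<nu> = 0")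
    case False
    with \<nu>0 have "0 < \<nu>" by simp
    then have "ln \<nu> \<le> - 2 / \<eta>" using \<nu> by (metis ln_exp ln_le_cancel_iff exp_gt_zero)
    then have "1 \<le> \<eta> / 2 * ln (1 / \<nu>)" using \<open>0 < \<nu>\<close> assms(2) by (simp add: ln_div field_simps)
    then have "\<nu> * 1 \<le> \<nu> * (\<eta> / 2 * ln (1 / \<nu>))" using \<nu>0 by (rule mult_left_mono)
    then show ?thesis by (simp add: mult_ac)
  qed simp
  moreover have "?m * deficit p V P = p * ln (1 / p) * ?I + ?m * ln ?m"
    using assms(6) by (simp add: deficit_def distrib_left)
  ultimately show ?thesis by linarith
qed

section \<open>Influential coordinates and induction on the dimension\<close>

text \<open>The law of total probability for coordinate j under the measure conditioned on P,
  according to the value of coordinate i.\<close>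

lemma cond_prob_split:
  assumes "finite V" "0 < p" "p < 1" "mono P" "0 < measure_pred p V P" "i \<in> V" "j \<in> V - {i}"
  defines "q \<equiv> cond_prob p V P i"
  shows "cond_prob p V P j = q * cond_prob p (V - {i}) (\<lambda>X. P (insert i X)) j
           + (1 - q) * cond_prob p (V - {i}) P j"
proof -
  let ?W = "V - {i}" and ?m = "measure_pred p V P"
  have j: "finite ?W" "i \<in> V - {j}" "j \<in> V" "V - {j} - {i} = ?W - {j}" "finite (V - {j})"
    using assms by auto
  have unnorm: "measure_pred p ?W Q * cond_prob p ?W Q j
      = p * measure_pred p (?W - {j}) (\<lambda>X. Q (insert j X))" if "mono Q" for Q
  proof (cases "measure_pred p ?W Q = 0")
    \<comment> \<open>Division by 0 makes the left side 0; the right side is a summand in a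
      vanishing sum of nonnegative terms.\<close>
    case True
    have "measure_pred p ?W Q = p * measure_pred p (?W - {j}) (\<lambda>X. Q (insert j X))
      + (1 - p) * measure_pred p (?W - {j}) Q"
      using j assms(7) by (intro measure_pred_split)
    moreover have "0 \<le> p * measure_pred p (?W - {j}) (\<lambda>X. Q (insert j X))"
      "0 \<le> (1 - p) * measure_pred p (?W - {j}) Q"
      using assms(2,3) by (simp_all add: measure_pred_nonneg)
    ultimately have "p * measure_pred p (?W - {j}) (\<lambda>X. Q (insert j X)) = 0"
      using True by linarith
    then show ?thesis by (simp add: True)
  qed (simp add: cond_prob_def)
  note c = cond_prob_bounds(3,4)[OF assms(1-6), folded q_def]
  have "?m * cond_prob p V P j = p * measure_pred p (V - {j}) (\<lambda>X. P (insert j X))"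
    using assms(5) by (simp add: cond_prob_def)
  also have "\<dots> = p * (p * measure_pred p (?W - {j}) (\<lambda>X. P (insert j (insert i X))))
      + (1 - p) * (p * measure_pred p (?W - {j}) (\<lambda>X. P (insert j X)))"
    unfolding measure_pred_split[OF j(5,2)] j(4) by (simp add: algebra_simps)
  also have "\<dots> = (q * ?m) * cond_prob p ?W (\<lambda>X. P (insert i X)) j
      + ((1 - q) * ?m) * cond_prob p ?W P j"
    unfolding c using unnorm[OF assms(4)] unnorm[OF mono_insert[OF assms(4), of i]]
    by (simp add: insert_commute mult.assoc)
  also have "\<dots> = ?m * (q * cond_prob p ?W (\<lambda>X. P (insert i X)) j
      + (1 - q) * cond_prob p ?W P j)" by (simp add: algebra_simps)
  finally show ?thesis using assms(5) by simp
qed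

text \<open>If no coordinate is influential, neither is any coordinate of a restriction: by
  \<open>cond_prob_split\<close>, \<open>q\<^sub>j - p\<close> is at least a fixed multiple of \<open>1 - q\<^sub>i\<close> (for \<open>f\<^sub>i\<^sup>-\<close>) or of \<open>q\<^sub>i\<close> (for \<open>f\<^sub>i\<^sup>+\<close>).
  The second bound is of order \<open>p\<close>, hence useless for small \<open>p\<close> unless \<open>q\<^sub>j - p\<close> is much smaller
  than \<open>p\<close>. So \<open>f\<^sub>i\<^sup>-\<close> is used whenever its deficit does not exceed \<open>\<delta>\<close>, in particular if
  \<open>h(q\<^sub>i) \<ge> q\<^sub>i \<delta>\<close>. If this fails for every coordinate, then all \<open>q\<^sub>j - p\<close> are \<open>O(p \<delta>)\<close> and \<open>f\<^sub>i\<^sup>+\<close> can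
  be used.\<close>
lemma influential_coordinate_or_large:
  assumes "0 < \<eta>" "0 < p" "p \<le> 1 - \<eta>" "0 < s" "s \<le> \<eta> / 2" "0 < c" "c \<le> 1"
    and gap: "\<And>q. p \<le> q \<Longrightarrow> q \<le> 1 - s \<Longrightarrow> c * (q - p) \<le> gap p q"
    and c0: "c\<^sub>0 < c * s * \<eta> / 4" "c\<^sub>0 \<le> c * exp (- 2 / \<eta>) / 3"
    and "finite V" "mono P" "0 < measure_pred p V P" "deficit p V P \<le> c\<^sub>0"
  shows "(\<exists>i\<in>V. 1 - s < cond_prob p V P i) \<or> 1 - measure_pred p V P \<le> exp (- 2 / \<eta>)"
  using assms(11-14)
proof (induction V arbitrary: P rule: finite_psubset_induct)
  case (psubset V P)
  note P = psubset.prems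
  show ?case
  proof (cases "V = {}")
    case True
    then show ?thesis using measure_pred_empty[of p P] P by simp
  next
    case nonempty: False
    show ?thesis
    proof (cases "\<exists>i\<in>V. 1 - s < cond_prob p V P i")
      case False
      let ?q = "cond_prob p V P" and ?\<delta> = "deficit p V P"
      let ?P1 = "\<lambda>i X. P (insert i X)"
      have p1: "p < 1" and s1: "s < 1" "\<eta> < 1" using assms by auto
      \<comment> \<open>The first bound excludes an influential coordinate in the restriction to 0,
        the second in the restriction to 1, and the third gives
        \<open>?q j \<le> 2 * p\<close>.\<close>
      have c0': "2 * c\<^sub>0 < c * (s * (\<eta> / 2))" "4 * c\<^sub>0 < c * \<eta>" "2 * c\<^sub>0 \<le> c"
      proof -
        show "2 * c\<^sub>0 < c * (s * (\<eta> / 2))" using c0(1) by simp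
        have "c * s * \<eta> \<le> c * 1 * \<eta>" using assms s1 by (intro mult_mono) auto
        then show *: "4 * c\<^sub>0 < c * \<eta>" using c0(1) by simp
        have "c * \<eta> \<le> c * 1" using assms s1 by (intro mult_left_mono) auto
        with * show "2 * c\<^sub>0 \<le> c" using assms(6) by linarith
      qed
      have \<delta>0: "0 \<le> ?\<delta>" using deficit_nonneg[OF psubset.hyps assms(2) p1 P(1,2)] .
      have q: "p \<le> ?q i" "?q i \<le> 1 - s" "c * (?q i - p) \<le> gap p (?q i)"
        "0 < measure_pred p (V - {i}) P" "0 < measure_pred p (V - {i}) (?P1 i)"
        "0 \<le> deficit p (V - {i}) P" "0 \<le> deficit p (V - {i}) (?P1 i)"
        "?\<delta> = gap p (?q i) + ?q i * deficit p (V - {i}) (?P1 i)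
           + (1 - ?q i) * deficit p (V - {i}) P"
        if "i \<in> V" for i
      proof -
        note b = cond_prob_bounds[OF psubset.hyps assms(2) p1 P(1,2) that]
        show "p \<le> ?q i" by (rule b(1))
        show "?q i \<le> 1 - s" using False that by force
        then show "c * (?q i - p) \<le> gap p (?q i)" by (intro gap b(1))
        have "0 < (1 - ?q i) * measure_pred p V P"
          using \<open>?q i \<le> 1 - s\<close> assms(4) P(2) by simp
        then show m: "0 < measure_pred p (V - {i}) P" unfolding b(4) using p1
          by (simp add: zero_less_mult_iff)
        then show m1: "0 < measure_pred p (V - {i}) (?P1 i)"
          using measure_pred_insert_ge[OF assms(2) p1 P(1), of "V - {i}" i] by simp
        show "0 \<le> deficit p (V - {i}) P" "0 \<le> deficit p (V - {i}) (?P1 i)"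
          using deficit_nonneg[OF _ assms(2) p1 P(1) m]
            deficit_nonneg[OF _ assms(2) p1 mono_insert[OF P(1)] m1] psubset.hyps by simp_all
        show "?\<delta> = gap p (?q i) + ?q i * deficit p (V - {i}) (?P1 i)
           + (1 - ?q i) * deficit p (V - {i}) P"
          by (rule deficit_split[OF psubset.hyps assms(2) p1 P(1,2) that])
      qed
      have near: "c * (?q i - p) \<le> c\<^sub>0" if "i \<in> V" for i
      proof -
        have "gap p (?q i) \<le> ?\<delta>" unfolding q(8)[OF that]
          using q(1,2,6,7)[OF that] assms(2,4) by simp
        then show ?thesis using q(3)[OF that] P(3) by linarith
      qed
      \<comment> \<open>Since \<open>1 - ?q i\<close> is at least s, an influential j of the
        restriction to 0 would contradict \<open>near\<close>. So this restriction has measure close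
        to 1, and P has at least the same measure by monotonicity.\<close>
      have minus: ?thesis if i: "i \<in> V" and le: "deficit p (V - {i}) P \<le> ?\<delta>" for i
      proof -
        have "1 - measure_pred p (V - {i}) P \<le> exp (- 2 / \<eta>)"
        proof (rule ccontr)
          assume neg: "\<not> ?thesis"
          have "V - {i} \<subset> V" using i by blast
          from psubset.IH[OF this P(1) q(4)[OF i] order_trans[OF le P(3)]] neg
          obtain j where j: "j \<in> V - {i}" "1 - s < cond_prob p (V - {i}) P j" by blast
          have "p \<le> cond_prob p (V - {i}) (?P1 i) j"
            using psubset.hyps
            by (intro cond_prob_bounds(1)[OF _ assms(2) p1 mono_insert[OF P(1)] q(5)[OF i] j(1)]) simp
          then have "?q i * p + (1 - ?q i) * (1 - s) \<le> ?q j"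
            unfolding cond_prob_split[OF psubset.hyps assms(2) p1 P(1,2) i j(1)]
            using q(1,2)[OF i] j(2) assms(2,4) by (intro add_mono mult_left_mono) auto
          then have "(1 - ?q i) * (1 - s - p) \<le> ?q j - p" by (simp add: algebra_simps)
          moreover have "s * (\<eta> / 2) \<le> (1 - ?q i) * (1 - s - p)"
            using q(2)[OF i] assms by (intro mult_mono) auto
          ultimately have "s * (\<eta> / 2) \<le> ?q j - p" by linarith
          then have "c * (s * (\<eta> / 2)) \<le> c * (?q j - p)" using assms by (intro mult_left_mono) auto
          also have "\<dots> \<le> c\<^sub>0" using near j by auto
          finally show False using c0' \<delta>0 P(3) by linarith
        qed
        moreover have "measure_pred p (V - {i}) P \<le> measure_pred p V P"
          unfolding measure_pred_split[OF psubset.hyps i, of p P]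
        proof -
          have "p * measure_pred p (V - {i}) P \<le> p * measure_pred p (V - {i}) (?P1 i)"
            using measure_pred_insert_ge[OF assms(2) p1 P(1)] assms(2) by simp
          then show "measure_pred p (V - {i}) P \<le> p * measure_pred p (V - {i}) (?P1 i)
              + (1 - p) * measure_pred p (V - {i}) P" by (simp add: algebra_simps)
        qed
        ultimately show ?thesis by simp
      qed
      show ?thesis
      proof (cases "\<exists>i\<in>V. ?q i * ?\<delta> \<le> gap p (?q i)")
        case True
        then obtain i where i: "i \<in> V" "?q i * ?\<delta> \<le> gap p (?q i)" by blast
        have "0 \<le> ?q i * deficit p (V - {i}) (?P1 i)" using q(1,7)[OF i(1)] assms(2) by simp
        then have "(1 - ?q i) * deficit p (V - {i}) P \<le> (1 - ?q i) * ?\<delta>"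
          using q(8)[OF i(1)] i(2) by (simp add: algebra_simps)
        then show ?thesis using minus[OF i(1)] q(2)[OF i(1)] assms(4) by simp
      next
        case gap_small: False
        \<comment> \<open>Bootstrapping: the bound \<open>?q j * c\<^sub>0\<close> first gives
          \<open>?q j \<le> 2 * p\<close>, and inserting this makes it proportional to p.\<close>
        have q_small: "c * (?q j - p) \<le> 2 * p * c\<^sub>0" if "j \<in> V" for j
        proof -
          have *: "c * (?q j - p) \<le> ?q j * c\<^sub>0"
          proof -
            have "c * (?q j - p) \<le> ?q j * ?\<delta>" using gap_small q(3)[OF that] that by force
            also have "\<dots> \<le> ?q j * c\<^sub>0" using P(3) q(1)[OF that] assms(2) by simp
            finally show ?thesis .
          qed
          also have "\<dots> \<le> ?q j * (c / 2)"
            using c0'(3) q(1)[OF that] assms(2) by (intro mult_left_mono) auto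
          finally have "c * ?q j \<le> c * (2 * p)" by (simp add: algebra_simps)
          then have "?q j \<le> 2 * p" using assms(6) by simp
          then have "?q j * c\<^sub>0 \<le> 2 * p * c\<^sub>0" using \<delta>0 P(3) by (intro mult_right_mono) auto
          with * show ?thesis by linarith
        qed
        obtain i where i: "i \<in> V" using nonempty by blast
        show ?thesis
        proof (cases "deficit p (V - {i}) P \<le> ?\<delta>")
          case True
          then show ?thesis by (rule minus[OF i])
        next
          case False
          \<comment> \<open>The deficit is a nonnegative gap plus an average of the two restricted
            deficits, so they cannot both exceed it.\<close>
          have "0 \<le> gap p (?q i)" using q(1,2)[OF i] assms p1 by (intro gap_nonneg) auto
          moreover have "(1 - ?q i) * ?\<delta> \<le> (1 - ?q i) * deficit p (V - {i}) P"
            using False q(2)[OF i] assms(4) by (intro mult_left_mono) auto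
          moreover have "(1 - ?q i) * ?\<delta> = ?\<delta> - ?q i * ?\<delta>" by (simp add: left_diff_distrib)
          ultimately have "?q i * deficit p (V - {i}) (?P1 i) \<le> ?q i * ?\<delta>"
            using q(8)[OF i] by linarith
          then have le: "deficit p (V - {i}) (?P1 i) \<le> ?\<delta>" using q(1)[OF i] assms(2) by simp
          have "1 - measure_pred p (V - {i}) (?P1 i) \<le> exp (- 2 / \<eta>)"
          proof (rule ccontr)
            assume neg: "\<not> ?thesis"
            have "V - {i} \<subset> V" using i by blast
            from psubset.IH[OF this mono_insert[OF P(1)] q(5)[OF i] order_trans[OF le P(3)]] neg
            obtain j where j: "j \<in> V - {i}" "1 - s < cond_prob p (V - {i}) (?P1 i) j" by blast
            have "p \<le> cond_prob p (V - {i}) P j"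
              using psubset.hyps
              by (intro cond_prob_bounds(1)[OF _ assms(2) p1 P(1) q(4)[OF i] j(1)]) simp
            then have "?q i * (1 - s) + (1 - ?q i) * p \<le> ?q j"
              unfolding cond_prob_split[OF psubset.hyps assms(2) p1 P(1,2) i j(1)]
              using q(1,2)[OF i] j(2) assms(2,4) by (intro add_mono mult_left_mono) auto
            then have "?q i * (1 - s - p) \<le> ?q j - p" by (simp add: algebra_simps)
            moreover have "p * (\<eta> / 2) \<le> ?q i * (1 - s - p)"
              using q(1)[OF i] assms by (intro mult_mono) auto
            ultimately have "p * (\<eta> / 2) \<le> ?q j - p" by linarith
            then have "c * (p * (\<eta> / 2)) \<le> c * (?q j - p)"
              using assms by (intro mult_left_mono) auto
            also have "\<dots> \<le> 2 * p * c\<^sub>0" using q_small j by auto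
            finally have "p * (c * \<eta>) \<le> p * (4 * c\<^sub>0)" by (simp add: mult_ac)
            then show False using c0'(2) assms(2) by simp
          qed
          note plus = this
          \<comment> \<open>P may have smaller measure than its restriction to 1, so the threshold
            is not inherited. \<open>deficit_ge_complement\<close> first improves it to
            \<open>c\<^sub>0\<close>, which leaves room for the loss.\<close>
          let ?\<nu> = "1 - measure_pred p (V - {i}) (?P1 i)"
          have \<nu>: "?\<nu> \<le> c\<^sub>0"
          proof (cases "?\<nu> = 0")
            case True
            then show ?thesis using \<delta>0 P(3) by simp
          next
            case False
            have fin: "finite (V - {i})" using psubset.hyps by simp
            have "0 < ?\<nu>" using False measure_pred_le_1[OF fin assms(2) p1, of "?P1 i"] by simp
            then have "ln ?\<nu> \<le> - 2 / \<eta>" using plus by (metis ln_exp ln_le_cancel_iff exp_gt_zero)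
            then have "1 \<le> \<eta> / 2 * ln (1 / ?\<nu>)"
              using \<open>0 < ?\<nu>\<close> assms(1) by (simp add: ln_div field_simps)
            then have "?\<nu> * 1 \<le> ?\<nu> * (\<eta> / 2 * ln (1 / ?\<nu>))"
              using \<open>0 < ?\<nu>\<close> by (intro mult_left_mono) auto
            also have "\<dots> \<le> measure_pred p (V - {i}) (?P1 i) * deficit p (V - {i}) (?P1 i)"
              using deficit_ge_complement[OF fin assms(1-3) mono_insert[OF P(1)] q(5)[OF i] plus]
              by (simp add: mult_ac)
            also have "\<dots> \<le> 1 * ?\<delta>"
              using measure_pred_le_1[OF fin assms(2) p1, of "?P1 i"] le q(5,7)[OF i]
              by (intro mult_mono) auto
            finally show ?thesis using P(3) by simp
          qed
          \<comment> \<open>The loss is (q - p)/p times the measure of P; the factor p in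
            \<open>q_small\<close> cancels the denominator.\<close>
          have "measure_pred p (V - {i}) (?P1 i) - measure_pred p V P \<le> 2 * c\<^sub>0 / c"
          proof -
            have "p * (measure_pred p (V - {i}) (?P1 i) - measure_pred p V P)
                = (?q i - p) * measure_pred p V P"
              using cond_prob_bounds(3)[OF psubset.hyps assms(2) p1 P(1,2) i]
              by (simp add: algebra_simps)
            also have "\<dots> \<le> (?q i - p) * 1"
              using measure_pred_le_1[OF psubset.hyps assms(2) p1, of P] q(1)[OF i]
              by (intro mult_left_mono) auto
            also have "\<dots> \<le> p * (2 * c\<^sub>0 / c)"
              using q_small[OF i] assms(6) by (simp add: field_simps)
            finally show ?thesis using assms(2) by (rule mult_left_le_imp_le)
          qed
          moreover have "c\<^sub>0 \<le> c\<^sub>0 / c"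
            using \<delta>0 P(3) assms(6,7) by (simp add: pos_le_divide_eq mult_left_le)
          \<comment> \<open>The two losses, \<open>c\<^sub>0\<close> and
            \<open>2 * c\<^sub>0 / c\<close>, explain the divisor 3 in the assumption on
            \<open>c\<^sub>0\<close>.\<close>
          moreover have "3 * c\<^sub>0 / c \<le> exp (- 2 / \<eta>)" using c0(2) assms(6) by (simp add: field_simps)
          moreover have "3 * c\<^sub>0 / c = c\<^sub>0 / c + 2 * c\<^sub>0 / c"
            by (simp add: add_divide_distrib[symmetric])
          ultimately have "1 - measure_pred p V P \<le> exp (- 2 / \<eta>)" using \<nu> by linarith
          then show ?thesis ..
        qed
      qed
    qed simp
  qed
qed

text \<open>The logarithm is taken of a fixed bound \<open>e\<close> and not of the deficit itself: the bound is then
  linear in the deficit, and the induction loses no constant.\<close>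
lemma close_to_subcube:
  assumes "0 < \<eta>" "0 < p" "p \<le> 1 - \<eta>" "0 < s" "s \<le> \<eta> / 2" "s \<le> exp (- 2)" "0 < c" "c \<le> 1"
    and gap: "\<And>q. p \<le> q \<Longrightarrow> q \<le> 1 - s \<Longrightarrow> c * (q - p) \<le> gap p q"
    and gap1: "\<And>t. 0 \<le> t \<Longrightarrow> t \<le> s \<Longrightarrow> t / 2 * ln (1 / t) \<le> gap p (1 - t)"
    and c0: "c\<^sub>0 < c * s * \<eta> / 4" "c\<^sub>0 \<le> c * exp (- 2 / \<eta>) / 3"
    and e: "0 < e" "e \<le> c\<^sub>0"
    and "finite V" "mono P" "0 < measure_pred p V P" "deficit p V P \<le> e"
  shows "\<exists>F\<subseteq>V. measure_pred p V (\<lambda>X. P X \<noteq> (F \<subseteq> X))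
           \<le> 2 / \<eta> * (deficit p V P / ln (1 / e)) * measure_pred p V P"
  using assms(15-18)
proof (induction V arbitrary: P rule: finite_psubset_induct)
  case (psubset V P)
  note P = psubset.prems
  let ?\<delta> = "deficit p V P" and ?L = "ln (1 / e)" and ?m = "measure_pred p V P"
  have p1: "p < 1" "\<eta> < 1" using assms by auto
  have e1: "e < 1"
  proof -
    have "c * exp (- 2 / \<eta>) \<le> 1 * 1" using assms by (intro mult_mono) auto
    then show ?thesis using c0(2) e by simp
  qed
  have L: "0 < ?L" using e e1 by simp
  have \<delta>0: "0 \<le> ?\<delta>" using deficit_nonneg[OF psubset.hyps assms(2) p1(1) P(1,2)] .
  \<comment> \<open>A bound on t ln (1/t) forces t <= e once the logarithm is large, and then ln
    (1/t) may be replaced by the fixed ln (1/e). It is used with k = 1 and with k = \<eta>.\<close>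
  have log: "t \<le> e \<and> t * ?L \<le> t * ln (1 / t)" if "0 < t" "t \<le> 1" "b \<le> e" "2 \<le> ln (1 / t) * k"
    "t * (ln (1 / t) * k) \<le> 2 * b" for t b k
  proof -
    have "t * 2 \<le> t * (ln (1 / t) * k)" using that by (intro mult_left_mono) auto
    then have "t \<le> e" using that by linarith
    then show ?thesis using that e by (auto intro!: mult_left_mono simp: ln_div)
  qed
  from influential_coordinate_or_large[OF assms(1-5,7,8) gap c0 psubset.hyps P(1,2)] P(3) e(2)
  consider i where "i \<in> V" "1 - s < cond_prob p V P i" | "1 - ?m \<le> exp (- 2 / \<eta>)"
    by force
  then show ?case
  proof cases
    case (1 i)
    \<comment> \<open>\<open>measure_pred p ?W P\<close> may be \<open>0\<close>, and then \<open>q = 1\<close> and \<open>deficit p ?W P\<close> is a junk value.\<close>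
    let ?P1 = "\<lambda>X. P (insert i X)" and ?W = "V - {i}"
    define q where "q = cond_prob p V P i"
    define t where "t = 1 - q"
    note b = cond_prob_bounds[OF psubset.hyps assms(2) p1(1) P(1,2) 1(1), folded q_def]
    have t: "0 \<le> t" "t \<le> s" "t < 1" using b(1,2) 1(2) assms(2) by (auto simp: t_def q_def)
    have m1: "0 < measure_pred p ?W ?P1"
      using b(1,3) assms(2) P(2) by (smt (verit) mult_pos_pos zero_less_mult_pos)
    have split: "?\<delta> = gap p q + q * deficit p ?W ?P1 + (1 - q) * deficit p ?W P"
      unfolding q_def by (rule deficit_split[OF psubset.hyps assms(2) p1(1) P(1,2) 1(1)])
    have "0 \<le> q * deficit p ?W ?P1"
      using deficit_nonneg[OF _ assms(2) p1(1) mono_insert[OF P(1)] m1] psubset.hyps b(1) assms(2)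
      by simp
    moreover have minus: "0 \<le> (1 - q) * deficit p ?W P"
    proof (cases "measure_pred p ?W P = 0")
      case True
      then show ?thesis using b(4) P(2) by simp
    next
      case False
      then have "0 < measure_pred p ?W P"
        using measure_pred_nonneg[OF assms(2) p1(1), of ?W P] by simp
      then show ?thesis
        using deficit_nonneg[OF _ assms(2) p1(1) P(1), of ?W] psubset.hyps b(2) by simp
    qed
    ultimately have gle: "gap p q \<le> e" using split P(3) by linarith
    have gt: "t / 2 * ln (1 / t) \<le> gap p q" using gap1[OF t(1,2)] by (simp add: t_def)
    have ln_t: "2 \<le> ln (1 / t)" if "0 < t"
    proof -
      have "t \<le> exp (- 2)" using t(2) assms(6) by linarith
      then have "ln t \<le> - 2" using that by (metis ln_exp ln_le_cancel_iff exp_gt_zero)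
      then show ?thesis using that by (simp add: ln_div)
    qed
    have tg: "t \<le> gap p q" and tL: "t * ?L / 2 \<le> gap p q"
    proof -
      have "t \<le> gap p q \<and> t * ?L / 2 \<le> gap p q"
      proof (cases "t = 0")
        case True
        then show ?thesis using gt by simp
      next
        case False
        then have "0 < t" using t by simp
        have "t * 2 \<le> t * ln (1 / t)" using ln_t[OF \<open>0 < t\<close>] t by (intro mult_left_mono) auto
        then have "t \<le> gap p q" using gt by simp
        moreover have "t * ?L \<le> t * ln (1 / t)"
          using log[of t "gap p q" 1] ln_t \<open>0 < t\<close> t gle gt by simp
        ultimately show ?thesis using gt by simp
      qed
      then show "t \<le> gap p q" "t * ?L / 2 \<le> gap p q" by auto
    qed
    \<comment> \<open>The restriction has to meet the hypothesis with the same e: the gap pays at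
      least t, and e - t <= (1 - t) e because e < 1.\<close>
    have "q * deficit p ?W ?P1 \<le> q * e"
    proof -
      have "t * e \<le> t * 1" using e1 t by (intro mult_left_mono) auto
      then have "e - t \<le> q * e" by (simp add: t_def algebra_simps)
      then show ?thesis using split P(3) minus tg by linarith
    qed
    then have "deficit p ?W ?P1 \<le> e" using b(1) assms(2) by simp
    then obtain F where F: "F \<subseteq> ?W" "measure_pred p ?W (\<lambda>X. P (insert i X) \<noteq> (F \<subseteq> X))
        \<le> 2 / \<eta> * (deficit p ?W ?P1 / ?L) * measure_pred p ?W ?P1"
      using psubset.IH[OF _ mono_insert[OF P(1)] m1] 1(1) by blast
    \<comment> \<open>Where coordinate i is 1, the distance is that of the restriction. Where it is
      0, the subcube is empty and all of P counts, which is the fraction t of its measure.\<close>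
    have "measure_pred p V (\<lambda>X. P X \<noteq> (insert i F \<subseteq> X))
        = p * measure_pred p ?W (\<lambda>X. P (insert i X) \<noteq> (insert i F \<subseteq> insert i X))
        + (1 - p) * measure_pred p ?W (\<lambda>X. P X \<noteq> (insert i F \<subseteq> X))"
      using psubset.hyps 1(1) by (rule measure_pred_split)
    also have "measure_pred p ?W (\<lambda>X. P (insert i X) \<noteq> (insert i F \<subseteq> insert i X))
        = measure_pred p ?W (\<lambda>X. P (insert i X) \<noteq> (F \<subseteq> X))"
      using F(1) by (intro measure_pred_cong) auto
    also have "measure_pred p ?W (\<lambda>X. P X \<noteq> (insert i F \<subseteq> X)) = measure_pred p ?W P"
      by (intro measure_pred_cong) auto
    also have "p * measure_pred p ?W (\<lambda>X. P (insert i X) \<noteq> (F \<subseteq> X)) + (1 - p) * measure_pred p ?W P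
      \<le> p * (2 / \<eta> * (deficit p ?W ?P1 / ?L) * measure_pred p ?W ?P1)
        + (1 - p) * measure_pred p ?W P"
      using assms(2) by (intro add_right_mono mult_left_mono F(2)) simp
    also have "\<dots> = 2 / \<eta> * (deficit p ?W ?P1 / ?L) * (q * ?m) + t * ?m"
      unfolding b(3) t_def b(4) by simp
    also have "\<dots> = (2 / \<eta> * (q * deficit p ?W ?P1 / ?L) + t) * ?m"
      by (simp add: algebra_simps)
    \<comment> \<open>The gap pays t ln (1/e) / 2, which contributes t/\<eta> to the right side and
      so covers the additional t.\<close>
    also have "\<dots> \<le> (2 / \<eta> * (?\<delta> / ?L)) * ?m"
    proof (rule mult_right_mono)
      have "t * \<eta> \<le> t * 1" using t p1 by (intro mult_left_mono) auto
      then have "t \<le> t / \<eta>" using assms(1) by (simp add: field_simps)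
      moreover have "q * deficit p ?W ?P1 / ?L \<le> (?\<delta> - t * ?L / 2) / ?L"
        using split minus tL L by (intro divide_right_mono) auto
      then have "2 / \<eta> * (q * deficit p ?W ?P1 / ?L) \<le> 2 / \<eta> * (?\<delta> / ?L - t / 2)"
        using L assms(1) by (intro mult_left_mono) (auto simp: diff_divide_distrib)
      ultimately show "2 / \<eta> * (q * deficit p ?W ?P1 / ?L) + t \<le> 2 / \<eta> * (?\<delta> / ?L)"
        by (simp add: right_diff_distrib)
    qed (use P in simp)
    finally show ?thesis using F(1) 1(1) by (intro exI[of _ "insert i F"]) auto
  next
    case 2
    \<comment> \<open>The witness is the whole cube, F = {}, at distance \<nu>.\<close>
    define \<nu> where "\<nu> = 1 - ?m"
    have ge: "\<eta> / 2 * (\<nu> * ln (1 / \<nu>)) \<le> ?m * ?\<delta>"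
      using deficit_ge_complement[OF psubset.hyps assms(1-3) P(1,2) 2] by (simp add: \<nu>_def)
    have m1: "?m \<le> 1" using psubset.hyps assms(2) p1(1) by (rule measure_pred_le_1)
    have "\<nu> * ?L * \<eta> \<le> 2 * (?m * ?\<delta>)"
    proof (cases "\<nu> = 0")
      case True
      then show ?thesis using \<delta>0 P(2) by simp
    next
      case False
      then have \<nu>: "0 < \<nu>" "\<nu> \<le> 1" using m1 P(2) by (auto simp: \<nu>_def)
      then have "ln \<nu> \<le> - 2 / \<eta>" using 2 unfolding \<nu>_def[symmetric]
        by (metis ln_exp ln_le_cancel_iff exp_gt_zero)
      then have "2 \<le> ln (1 / \<nu>) * \<eta>" using \<nu>(1) assms(1) by (simp add: ln_div field_simps)
      moreover have "?m * ?\<delta> \<le> 1 * e" using m1 P(2,3) \<delta>0 by (intro mult_mono) auto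
      ultimately have "\<nu> * ?L \<le> \<nu> * ln (1 / \<nu>)"
        using log[of \<nu> "?m * ?\<delta>" \<eta>] \<nu> ge by (simp add: mult_ac)
      then have "\<nu> * ?L * \<eta> \<le> \<nu> * ln (1 / \<nu>) * \<eta>"
        using assms(1) by (intro mult_right_mono) auto
      also have "\<dots> \<le> 2 * (?m * ?\<delta>)" using ge by (simp add: mult_ac)
      finally show ?thesis .
    qed
    then have "\<nu> \<le> 2 / \<eta> * (?\<delta> / ?L) * ?m" using L assms(1) by (simp add: field_simps)
    moreover have "measure_pred p V (\<lambda>X. P X \<noteq> ({} \<subseteq> X)) = \<nu>"
      using measure_pred_not[OF psubset.hyps, of p P] by (simp add: \<nu>_def)
    ultimately show ?thesis by (intro exI[of _ "{}"]) auto
  qed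
qed

section \<open>Transfer to the cube\<close>

text \<open>The restriction discards elements of X outside {1..n}, so the result lies in the cube
  for every X.\<close>

definition point :: "nat \<Rightarrow> nat set \<Rightarrow> nat \<Rightarrow> nat" where
  "point n X = (\<lambda>j\<in>{1..n}. of_bool (j \<in> X))"

lemma bij_betw_point: "bij_betw (point n) (Pow {1..n}) (cube n)"
proof (rule bij_betwI[where g = "\<lambda>x. {j \<in> {1..n}. x j = 1}"])
  show "point n \<in> Pow {1..n} \<rightarrow> cube n" by (auto simp: point_def cube_def)
  show "point n {j \<in> {1..n}. x j = 1} = x" if "x \<in> cube n" for x
  proof
    fix j show "point n {j \<in> {1..n}. x j = 1} j = x j"
      using that PiE_mem[of x "{1..n}" "\<lambda>_. {0, 1}" j] PiE_arb[of x "{1..n}" "\<lambda>_. {0, 1}" j]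
      by (auto simp: point_def cube_def restrict_def)
  qed
qed (auto simp: point_def)

lemma point_in_cube: "point n X \<in> cube n"
  by (auto simp: point_def cube_def)

lemma flip_point:
  assumes "i \<in> {1..n}" "i \<notin> X"
  shows "flip i (point n X) = point n (insert i X)" "flip i (point n (insert i X)) = point n X"
  using assms by (auto simp: flip_def point_def fun_eq_iff)

lemma biased_weight_point:
  assumes "X \<subseteq> {1..n}"
  shows "biased_weight n p (point n X) = p ^ card X * (1 - p) ^ card ({1..n} - X)"
proof -
  have "(\<Sum>i=1..n. point n X i) = (\<Sum>i=1..n. of_bool (i \<in> X))"
    by (rule sum.cong) (auto simp: point_def)
  also have "\<dots> = card X" using assms by (simp add: Int_absorb1)
  finally show ?thesis
    using assms by (simp add: biased_weight_def card_Diff_subset finite_subset)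
qed

lemma sum_cube_eq:
  "(\<Sum>x\<in>cube n. biased_weight n p x * of_bool (Q x)) = measure_pred p {1..n} (\<lambda>X. Q (point n X))"
  unfolding measure_pred_def sum.reindex_bij_betw[OF bij_betw_point, symmetric]
  by (rule sum.cong) (auto simp: biased_weight_point)

lemma biased_measure_eq:
  "biased_measure n p A = measure_pred p {1..n} (\<lambda>X. point n X \<in> A)"
proof -
  have fin: "finite (cube n)" by (simp add: cube_def finite_PiE)
  show ?thesis
    unfolding biased_measure_def sum_cube_eq[of n p "\<lambda>x. x \<in> A", symmetric]
    by (rule sum.mono_neutral_cong_left) (use fin in auto)
qed

lemma biased_expectation_eq:
  assumes "boolean_function n f"
  shows "biased_expectation n p f = measure_pred p {1..n} (\<lambda>X. f (point n X) = 1)"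
  unfolding biased_expectation_def sum_cube_eq[of n p "\<lambda>x. f x = 1", symmetric]
  using assms by (intro sum.cong) (auto simp: boolean_function_def Pi_iff)

lemma mono_point:
  assumes "boolean_function n f" "monotone_increasing n f"
  shows "mono (\<lambda>X. f (point n X) = 1)"
proof (rule monoI, rule le_boolI)
  fix X Y :: "nat set" assume XY: "X \<subseteq> Y" and 1: "f (point n X) = 1"
  have "f (point n X) \<le> f (point n Y)"
    using XY by (intro assms(2)[unfolded monotone_increasing_def, rule_format] point_in_cube)
      (auto simp: point_def)
  moreover have "f (point n Y) \<in> {0, 1}"
    using assms(1) point_in_cube by (auto simp: boolean_function_def)
  ultimately show "f (point n Y) = 1" using 1 by auto
qed

lemma measure_pred_noteq:
  assumes "finite V" "\<And>X. X \<subseteq> V \<Longrightarrow> P X \<Longrightarrow> Q X"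
  shows "measure_pred p V (\<lambda>X. Q X \<noteq> P X) = measure_pred p V Q - measure_pred p V P"
  unfolding measure_pred_def sum_subtractf[symmetric]
  by (rule sum.cong) (use assms in \<open>auto simp: of_bool_def\<close>)

text \<open>Whether flipping coordinate i changes f does not depend on that coordinate, so the
  weights p and 1 - p add up to 1. By monotonicity the probability of a change is a difference of
  measures.\<close>

lemma influence_eq:
  assumes "boolean_function n f" "monotone_increasing n f" "i \<in> {1..n}"
  defines "P \<equiv> \<lambda>X. f (point n X) = 1"
  shows "influence n p i f = measure_pred p ({1..n} - {i}) (\<lambda>X. P (insert i X))
           - measure_pred p ({1..n} - {i}) P"
proof -
  let ?W = "{1..n} - {i}"
  have eq: "f (point n X) \<noteq> f (point n Y) \<longleftrightarrow> P X \<noteq> P Y" for X Y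
  proof -
    have "f (point n X) \<in> {0, 1}" "f (point n Y) \<in> {0, 1}"
      using assms(1) point_in_cube by (auto simp: boolean_function_def)
    then show ?thesis by (auto simp: P_def)
  qed
  have mono: "P X \<Longrightarrow> P (insert i X)" for X
    using monoD[OF mono_point[OF assms(1,2)] subset_insertI] by (auto simp: P_def)
  have "influence n p i f
      = measure_pred p {1..n} (\<lambda>X. f (point n X) \<noteq> f (flip i (point n X)))"
    by (simp add: influence_def biased_measure_eq point_in_cube)
  also have "\<dots> = p * measure_pred p ?W (\<lambda>X. P (insert i X) \<noteq> P X)
      + (1 - p) * measure_pred p ?W (\<lambda>X. P (insert i X) \<noteq> P X)"
  proof -
    have "measure_pred p ?W (\<lambda>X. f (point n (insert i X)) \<noteq> f (flip i (point n (insert i X))))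
        = measure_pred p ?W (\<lambda>X. P (insert i X) \<noteq> P X)"
      "measure_pred p ?W (\<lambda>X. f (point n X) \<noteq> f (flip i (point n X)))
        = measure_pred p ?W (\<lambda>X. P (insert i X) \<noteq> P X)"
      using assms(3) by (intro measure_pred_cong; subst flip_point; auto simp: eq[unfolded not_not])+
    then show ?thesis using measure_pred_split[of "{1..n}" i p] assms(3) by simp
  qed
  also have "\<dots> = measure_pred p ?W (\<lambda>X. P (insert i X) \<noteq> P X)" by (simp add: algebra_simps)
  also have "\<dots> = measure_pred p ?W (\<lambda>X. P (insert i X)) - measure_pred p ?W P"
    using mono by (intro measure_pred_noteq) auto
  finally show ?thesis .
qed

lemma total_influence_eq:
  assumes "boolean_function n f" "monotone_increasing n f"
  shows "total_influence n p f = influence_pred p {1..n} (\<lambda>X. f (point n X) = 1)"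
  unfolding total_influence_def influence_pred_def
  using influence_eq[OF assms] by (intro sum.cong) auto

lemma subcube_up_set:
  assumes "F \<subseteq> {1..n}"
  defines "S \<equiv> {x \<in> cube n. \<forall>i\<in>F. x i = 1}"
  shows "subcube n S" "monotone_increasing_set n S" "point n X \<in> S \<longleftrightarrow> F \<subseteq> X"
proof -
  show "subcube n S"
    unfolding subcube_def S_def using assms by (intro exI[of _ F] exI[of _ "\<lambda>_. 1"]) auto
  show "monotone_increasing_set n S"
    unfolding monotone_increasing_set_def monotone_increasing_def
  proof (intro ballI impI)
    fix x y assume x: "x \<in> cube n" and y: "y \<in> cube n" and le: "\<forall>i\<in>{1..n}. x i \<le> y i"
    have "y \<in> S" if "x \<in> S"
    proof -
      have "y i = 1" if "i \<in> F" for i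
      proof -
        have i: "i \<in> {1..n}" using assms(1) that by blast
        have "y i \<in> {0, 1}" using y i unfolding cube_def by (rule PiE_mem)
        moreover have "x i \<le> y i" using le i by blast
        moreover have "x i = 1" using \<open>x \<in> S\<close> that by (simp add: S_def)
        ultimately show ?thesis by auto
      qed
      then show ?thesis using y by (simp add: S_def)
    qed
    then show "(indicator S x :: nat) \<le> indicator S y" by (auto simp: indicator_def)
  qed
  have "point n X \<in> S \<longleftrightarrow> (\<forall>i\<in>F. point n X i = 1)" by (simp add: S_def point_in_cube)
  also have "\<dots> \<longleftrightarrow> F \<subseteq> X" using assms(1) by (auto simp: point_def subset_iff)
  finally show "point n X \<in> S \<longleftrightarrow> F \<subseteq> X" .
qed

section \<open>Choice of the constants and the theorem\<close>

text \<open>This fixes s, c and \<open>c\<^sub>0\<close> before p, V and P, so that they depend on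
  \<eta> only.\<close>

lemma biased_stability:
  fixes \<eta> :: real
  assumes "0 < \<eta>" "\<eta> < 1"
  obtains c\<^sub>0 where "0 < c\<^sub>0"
    "\<And>p e V (P :: nat set \<Rightarrow> bool). \<lbrakk>0 < p; p \<le> 1 - \<eta>; 0 < e; e \<le> c\<^sub>0; finite V; mono P;
       0 < measure_pred p V P; deficit p V P \<le> e\<rbrakk> \<Longrightarrow>
       \<exists>F\<subseteq>V. measure_pred p V (\<lambda>X. P X \<noteq> (F \<subseteq> X))
           \<le> 2 / \<eta> * (deficit p V P / ln (1 / e)) * measure_pred p V P"
proof
  define K where "K = 1 + ln (1 / \<eta>)"
  define s where "s = min (exp (- 2 * K)) (\<eta> / 2)"
  define c where "c = min 1 (s / 2 * ln (1 / s))"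
  \<comment> \<open>The divisor 5 yields the strict inequality with divisor 4 that
    \<open>close_to_subcube\<close> asks for.\<close>
  define c0 where "c0 = min (c * s * \<eta> / 5) (c * exp (- 2 / \<eta>) / 3)"
  have K: "1 \<le> K" using assms by (simp add: K_def)
  have s: "0 < s" "s \<le> \<eta> / 2" "s < 1" "s \<le> exp (- 2 * K)" "s \<le> exp (- 2)"
  proof -
    show "0 < s" "s \<le> \<eta> / 2" "s < 1" "s \<le> exp (- 2 * K)" using assms by (auto simp: s_def)
    have "exp (- 2 * K) \<le> exp (- 2)" using K by simp
    with \<open>s \<le> exp (- 2 * K)\<close> show "s \<le> exp (- 2)" by linarith
  qed
  have c: "0 < c" "c \<le> 1" "c \<le> s / 2 * ln (1 / s)" using s by (auto simp: c_def)
  have "0 < c * s * \<eta>" using c s assms by simp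
  then have c0: "c0 < c * s * \<eta> / 4" "c0 \<le> c * exp (- 2 / \<eta>) / 3" unfolding c0_def by linarith+
  show "0 < c0" using c s assms by (simp add: c0_def)
  fix p e :: real and V and P :: "nat set \<Rightarrow> bool"
  assume p: "0 < p" "p \<le> 1 - \<eta>" and e: "0 < e" "e \<le> c0"
    and V: "finite V" "mono P" "0 < measure_pred p V P" "deficit p V P \<le> e"
  have K': "bin_entropy p / (1 - p) \<le> K" using bin_entropy_ratio_le[OF assms(1) p] by (simp add: K_def)
  have p1: "p < 1" using p assms by simp
  have gap: "c * (q - p) \<le> gap p q" if "p \<le> q" "q \<le> 1 - s" for q
  proof -
    have "c * (q - p) \<le> s / 2 * ln (1 / s) * (q - p)" using c that by (intro mult_right_mono) auto
    also have "\<dots> \<le> gap p q" using gap_lower_bound[OF p(1) p1 K' s(1,4,3) that] .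
    finally show ?thesis .
  qed
  have gap1: "t / 2 * ln (1 / t) \<le> gap p (1 - t)" if "0 \<le> t" "t \<le> s" for t
    using gap_near_1[OF p(1) p1 K' that(1)] that s by simp
  show "\<exists>F\<subseteq>V. measure_pred p V (\<lambda>X. P X \<noteq> (F \<subseteq> X))
           \<le> 2 / \<eta> * (deficit p V P / ln (1 / e)) * measure_pred p V P"
    by (rule close_to_subcube[OF assms(1) p s(1,2,5) c(1,2) gap gap1 c0 e V])
qed

text \<open>The zero function has to be excluded: it satisfies the influence bound with both sides
  0, but every subcube has positive measure.\<close>

theorem theorem1p8:
  fixes \<eta> :: real
  assumes "\<eta> > 0"
  shows "\<exists>C\<^sub>1 c\<^sub>0 :: real. C\<^sub>1 > 0 \<and> c\<^sub>0 > 0 \<and>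
    (\<forall>(n::nat) (p::real) (\<epsilon>::real) (f :: (nat \<Rightarrow> nat) \<Rightarrow> nat).
       n \<ge> 1 \<longrightarrow> 0 < p \<longrightarrow> p \<le> 1 - \<eta> \<longrightarrow> \<epsilon> \<le> c\<^sub>0 / ln (1 / p) \<longrightarrow>
       boolean_function n f \<longrightarrow> monotone_increasing n f \<longrightarrow> (\<exists>x\<in>cube n. f x \<noteq> 0) \<longrightarrow>
       p * total_influence n p f
         \<le> biased_expectation n p f * (log p (biased_expectation n p f) + \<epsilon>) \<longrightarrow>
       (\<exists>S. subcube n S \<and> monotone_increasing_set n S \<and>
          biased_measure n p (fun_sym_diff n f (indicator S))
            \<le> C\<^sub>1 * (\<epsilon> * ln (1 / p) / ln (1 / (\<epsilon> * ln (1 / p)))) * biased_expectation n p f))"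
proof (cases "\<eta> < 1")
  case False
  then show ?thesis by (intro exI[of _ 1]) auto
next
  case True
  obtain c0 where c0: "0 < c0"
    and stab: "\<And>p e V (P :: nat set \<Rightarrow> bool). \<lbrakk>0 < p; p \<le> 1 - \<eta>; 0 < e; e \<le> c0; finite V; mono P;
       0 < measure_pred p V P; deficit p V P \<le> e\<rbrakk> \<Longrightarrow>
       \<exists>F\<subseteq>V. measure_pred p V (\<lambda>X. P X \<noteq> (F \<subseteq> X))
           \<le> 2 / \<eta> * (deficit p V P / ln (1 / e)) * measure_pred p V P"
    using biased_stability[OF assms True] by blast
  \<comment> \<open>The bound 1/2 keeps e below 1, so that ln (1/e) is positive.\<close>
  define c1 where "c1 = min c0 (1 / 2)"
  show ?thesis
  proof (rule exI[of _ "2 / \<eta>"], rule exI[of _ c1], intro conjI allI impI)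
    show "0 < 2 / \<eta>" "0 < c1" using assms c0 by (auto simp: c1_def)
    fix n :: nat and p \<epsilon> :: real and f
    assume p: "0 < p" "p \<le> 1 - \<eta>" and \<epsilon>: "\<epsilon> \<le> c1 / ln (1 / p)"
      and f: "boolean_function n f" "monotone_increasing n f" "\<exists>x\<in>cube n. f x \<noteq> 0"
      and small: "p * total_influence n p f
         \<le> biased_expectation n p f * (log p (biased_expectation n p f) + \<epsilon>)"
    let ?V = "{1..n}"
    define P where "P X \<longleftrightarrow> f (point n X) = 1" for X
    let ?m = "measure_pred p ?V P" and ?\<delta> = "deficit p ?V P" and ?l = "ln (1 / p)"
    define e where "e = \<epsilon> * ?l"
    have p1: "p < 1" and l: "0 < ?l" using p assms by auto
    have E: "biased_expectation n p f = ?m" and I: "total_influence n p f = influence_pred p ?V P"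
      and mono: "mono P"
      using biased_expectation_eq[OF f(1)] total_influence_eq[OF f(1,2)] mono_point[OF f(1,2)]
      by (simp_all add: P_def[abs_def])
    have m: "0 < ?m"
    proof -
      obtain x where x: "x \<in> cube n" "f x \<noteq> 0" using f(3) by blast
      then obtain X where X: "X \<subseteq> ?V" "x = point n X"
        using bij_betw_imp_surj_on[OF bij_betw_point, of n] by auto
      have "f x \<in> {0, 1}" using f(1) x(1) unfolding boolean_function_def by blast
      then have "P X" using x X(2) by (simp add: P_def)
      then have "?m \<noteq> 0" using measure_pred_eq_0_iff[of ?V p P] p p1 X(1) by auto
      then show ?thesis using measure_pred_nonneg[OF p(1) p1, of ?V P] by simp
    qed
    have \<delta>0: "0 \<le> ?\<delta>" using deficit_nonneg[OF _ p(1) p1 mono m] by simp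
    have \<delta>: "?\<delta> \<le> e"
    proof -
      have "p * influence_pred p ?V P / ?m \<le> log p ?m + \<epsilon>"
        using small m by (simp add: E I pos_divide_le_eq mult.commute)
      then have "?l * (p * influence_pred p ?V P / ?m) \<le> ?l * (log p ?m + \<epsilon>)"
        using l by (intro mult_left_mono) auto
      moreover have "?l * log p ?m = - ln ?m"
        using p p1 by (simp add: log_def ln_div)
      ultimately show ?thesis by (simp add: deficit_def e_def algebra_simps)
    qed
    have e: "e \<le> c1" using \<epsilon> l by (simp add: e_def pos_le_divide_eq)
    obtain F where F: "F \<subseteq> ?V"
      "measure_pred p ?V (\<lambda>X. P X \<noteq> (F \<subseteq> X)) \<le> 2 / \<eta> * (e / ln (1 / e)) * ?m"
    proof (cases "0 < e")
      case True
      then obtain F where F: "F \<subseteq> ?V"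
        "measure_pred p ?V (\<lambda>X. P X \<noteq> (F \<subseteq> X)) \<le> 2 / \<eta> * (?\<delta> / ln (1 / e)) * ?m"
        using stab[OF p True _ _ mono m \<delta>] e by (auto simp: c1_def)
      note F(2)
      also have "2 / \<eta> * (?\<delta> / ln (1 / e)) * ?m \<le> 2 / \<eta> * (e / ln (1 / e)) * ?m"
        using \<delta> True e m assms
        by (intro mult_right_mono mult_left_mono divide_right_mono) (auto simp: c1_def)
      finally show ?thesis using F(1) that by blast
    next
      \<comment> \<open>The deficit lies between 0 and e, so both are 0. \<open>stab\<close> needs a
        positive bound, and \<open>c0\<close> serves, since a zero deficit makes the distance 0
        anyway.\<close>
      case False
      then have "e = 0" "?\<delta> = 0" using \<delta> \<delta>0 by auto
      then show ?thesis using stab[OF p c0 order_refl _ mono m] c0 that by auto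
    qed
    define S where "S = {x \<in> cube n. \<forall>i\<in>F. x i = 1}"
    note S = subcube_up_set[OF F(1), folded S_def]
    have "biased_measure n p (fun_sym_diff n f (indicator S))
        = measure_pred p ?V (\<lambda>X. P X \<noteq> (F \<subseteq> X))"
      unfolding biased_measure_eq
    proof (rule measure_pred_cong)
      fix X
      have "f (point n X) \<in> {0, 1}" using f(1) point_in_cube by (auto simp: boolean_function_def)
      then show "(point n X \<in> fun_sym_diff n f (indicator S)) = (P X \<noteq> (F \<subseteq> X))"
        by (auto simp: fun_sym_diff_def point_in_cube P_def S(3) indicator_def)
    qed
    then show "\<exists>S. subcube n S \<and> monotone_increasing_set n S \<and>
          biased_measure n p (fun_sym_diff n f (indicator S))
            \<le> 2 / \<eta> * (\<epsilon> * ?l / ln (1 / (\<epsilon> * ?l))) * biased_expectation n p f"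
      using S(1,2) F(2) by (intro exI[of _ S]) (simp add: E e_def)
  qed
qed

end
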